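(* Set $T_0=1$. Then the functions $T_n(\gamma_1,\dots,\gamma_n)$, $n=1,2,3,\dots$, satisfy the recursive formula $$T_n(\gamma_1,\dots,\gamma_n)=\gamma_1T_{n-1}(\gamma_1,\dots,\gamma_{n-1})+\sum_{k=1}^{n-1}T_k(\gamma_2,\dots,\gamma_{k+1})\Big[(1+\gamma_1)T_{n-k-1}(\gamma_1,\dots,\gamma_{n-k-1})-(1+\bar\gamma_1)T_{n-k}(\gamma_1,\dots,\gamma_{n-k})\Big]$$ in the complex variables $\gamma_1,\dots,\gamma_n$.
   Context: The functions $F_n$ of $n$ complex variables are defined inductively by $F_1(\gamma_1)=\gamma_1$ and, for $n\ge 2$, $$F_n(\gamma_1,\dots,\gamma_n)=(1-|\gamma_1|^2)F_{n-1}(\gamma_2,\dots,\gamma_n)-\bar\gamma_1\sum_{k=2}^{n-1}F_{n-k}(\gamma_2,\dots,\gamma_{n-k+1})F_k(\gamma_1,\dots,\gamma_k).$$ The polynomials $Q_n$ are defined inductively by $Q_1(x_1)=x_1$ and, for $n\ge2$, $$Q_n(x_1,\dots,x_n)=x_n+\sum_{k=1}^{n-1}x_{n-k}Q_k(x_1,\dots,x_k).$$ For $n\ge 1$, the function $T_n$ of $n$ complex variables is defined by $$T_n(\gamma_1,\dots,\gamma_n)=Q_n(F_1(\gamma_1),F_2(\gamma_1,\gamma_2),\dots,F_n(\gamma_1,\dots,\gamma_n)).$$ *)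

theory Defs imports Complex_Main begin

text \<open>
  A tuple \<open>(\<gamma>\<^sub>1, \<dots>, \<gamma>\<^sub>n)\<close> is given by a sequence \<open>\<gamma> :: nat \<Rightarrow> complex\<close>, of which only the entries
  \<open>\<gamma> 1, \<dots>, \<gamma> n\<close> matter (see the lemmas \<open>F_cong\<close>, \<open>Q_cong\<close>, \<open>T_cong\<close> below); the entry \<open>\<gamma> 0\<close> is
  never used.  The tuple \<open>(\<gamma>\<^sub>2, \<dots>, \<gamma>\<^sub>n\<^sub>+\<^sub>1)\<close> is then given by \<open>shift \<gamma>\<close>.
\<close>

definition shift :: "(nat \<Rightarrow> complex) \<Rightarrow> nat \<Rightarrow> complex" where
  "shift \<gamma> = (\<lambda>i. \<gamma> (i + 1))"

text \<open>The values of \<open>F 0\<close> and \<open>Q 0\<close> are irrelevant.\<close>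

fun F :: "nat \<Rightarrow> (nat \<Rightarrow> complex) \<Rightarrow> complex" where
  "F n \<gamma> =
    (if n = 0 then 0
     else if n = 1 then \<gamma> 1
     else (1 - (cmod (\<gamma> 1))\<^sup>2) * F (n - 1) (shift \<gamma>)
          - cnj (\<gamma> 1) * (\<Sum>k = 2..n - 1. F (n - k) (shift \<gamma>) * F k \<gamma>))"

fun Q :: "nat \<Rightarrow> (nat \<Rightarrow> complex) \<Rightarrow> complex" where
  "Q n x =
    (if n = 0 then 0
     else if n = 1 then x 1
     else x n + (\<Sum>k = 1..n - 1. x (n - k) * Q k x))"

declare F.simps [simp del] Q.simps [simp del]

definition T :: "nat \<Rightarrow> (nat \<Rightarrow> complex) \<Rightarrow> complex" where
  "T n \<gamma> = (if n = 0 then 1 else Q n (\<lambda>k. F k \<gamma>))"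

lemma F_cong:
  assumes "\<And>i. 1 \<le> i \<Longrightarrow> i \<le> n \<Longrightarrow> \<gamma> i = \<delta> i"
  shows "F n \<gamma> = F n \<delta>"
  using assms
proof (induction n arbitrary: \<gamma> \<delta> rule: less_induct)
  case (less n)
  show ?case
  proof (cases "n \<le> 1")
    case True
    then show ?thesis
      using less.prems by (cases "n = 0") (auto simp: F.simps)
  next
    case False
    have s: "F m (shift \<gamma>) = F m (shift \<delta>)" if "m < n" for m
      using that less.prems by (intro less.IH) (auto simp: shift_def)
    have f: "F m \<gamma> = F m \<delta>" if "m < n" for m
      using that less.prems by (intro less.IH) auto
    have "(\<Sum>k = 2..n - 1. F (n - k) (shift \<gamma>) * F k \<gamma>) =
          (\<Sum>k = 2..n - 1. F (n - k) (shift \<delta>) * F k \<delta>)"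
      using False by (intro sum.cong refl arg_cong2[of _ _ _ _ "(*)"] s f) auto
    moreover have "F (n - 1) (shift \<gamma>) = F (n - 1) (shift \<delta>)"
      using False by (intro s) auto
    moreover have "\<gamma> 1 = \<delta> 1"
      using False less.prems by auto
    ultimately show ?thesis
      using False by (simp add: F.simps[of n])
  qed
qed

lemma Q_cong:
  assumes "\<And>i. 1 \<le> i \<Longrightarrow> i \<le> n \<Longrightarrow> x i = y i"
  shows "Q n x = Q n y"
  using assms
proof (induction n rule: less_induct)
  case (less n)
  have q: "Q m x = Q m y" if "m < n" for m
    using that less.prems by (intro less.IH) auto
  have "(\<Sum>k = 1..n - 1. x (n - k) * Q k x) = (\<Sum>k = 1..n - 1. y (n - k) * Q k y)"
    by (intro sum.cong refl arg_cong2[of _ _ _ _ "(*)"] q less.prems) auto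
  then show ?case
    using less.prems[of n] less.prems[of 1] by (auto simp: Q.simps[of n])
qed

lemma T_cong:
  assumes "\<And>i. 1 \<le> i \<Longrightarrow> i \<le> n \<Longrightarrow> \<gamma> i = \<delta> i"
  shows "T n \<gamma> = T n \<delta>"
  unfolding T_def using assms by (auto intro!: Q_cong F_cong)

end

theory Submission
  imports Defs "HOL-Computational_Algebra.Formal_Power_Series"
begin

text \<open>
  Let \<open>f\<close>, \<open>g\<close> be the generating functions of \<open>F\<^sub>n(\<gamma>\<^sub>1, \<gamma>\<^sub>2, \<dots>)\<close> and \<open>F\<^sub>n(\<gamma>\<^sub>2, \<gamma>\<^sub>3, \<dots>)\<close>.  The recursion for
  \<open>F\<close> is the Schur-type relation \<open>f + cnj \<gamma>\<^sub>1 g f = z (\<gamma>\<^sub>1 + g)\<close>, and the recursion for \<open>Q\<close> says that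
  \<open>1 / (1 - f)\<close> and \<open>1 / (1 - g)\<close> generate the corresponding values of \<open>T\<close>.  Divided by the product
  of these two series, the claimed recursion becomes that relation.
\<close>

text \<open>Both end terms of the Cauchy product vanish, leaving the range \<open>1..n - 1\<close>
  that occurs in the recursion for \<open>Q\<close> and in the theorem.\<close>

lemma fps_mult_nth_no_const:
  fixes u v :: "'a::comm_semiring_1 fps"
  assumes "fps_nth u 0 = 0" "fps_nth v 0 = 0"
  shows "fps_nth (u * v) n = (\<Sum>k = 1..n - 1. fps_nth u k * fps_nth v (n - k))"
  unfolding fps_mult_nth
proof (rule sum.mono_neutral_right)
  show "\<forall>i\<in>{0..n} - {1..n - 1}. fps_nth u i * fps_nth v (n - i) = 0"
  proof
    fix i assume "i \<in> {0..n} - {1..n - 1}"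
    then have "i = 0 \<or> i = n" by auto
    then show "fps_nth u i * fps_nth v (n - i) = 0" using assms by auto
  qed
qed auto

definition F_fps :: "(nat \<Rightarrow> complex) \<Rightarrow> complex fps" where
  "F_fps \<gamma> = Abs_fps (\<lambda>n. F n \<gamma>)"

definition T_fps :: "(nat \<Rightarrow> complex) \<Rightarrow> complex fps" where
  "T_fps \<gamma> = Abs_fps (\<lambda>n. T n \<gamma>)"

lemma F_fps_nth [simp]: "fps_nth (F_fps \<gamma>) n = F n \<gamma>"
  by (simp add: F_fps_def)

lemma T_fps_nth [simp]: "fps_nth (T_fps \<gamma>) n = T n \<gamma>"
  by (simp add: T_fps_def)

lemma F_0 [simp]: "F 0 \<gamma> = 0"
  by (simp add: F.simps)

lemma F_1 [simp]: "F (Suc 0) \<gamma> = \<gamma> 1"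
  by (simp add: F.simps)

lemma T_0 [simp]: "T 0 \<gamma> = 1"
  by (simp add: T_def)

lemma F_fps_functional_equation:
  "F_fps \<gamma> + fps_const (cnj (\<gamma> 1)) * (F_fps \<gamma> * F_fps (shift \<gamma>)) =
   fps_X * (fps_const (\<gamma> 1) + F_fps (shift \<gamma>))"
proof (rule fps_ext)
  fix n
  have conv: "fps_nth (F_fps \<gamma> * F_fps (shift \<gamma>)) n =
      (\<Sum>k = 1..n - 1. F k \<gamma> * F (n - k) (shift \<gamma>))"
    by (subst fps_mult_nth_no_const) simp_all
  consider "n = 0" | "n = 1" | "n \<ge> 2" by linarith
  then show "fps_nth (F_fps \<gamma> + fps_const (cnj (\<gamma> 1)) * (F_fps \<gamma> * F_fps (shift \<gamma>))) n =
      fps_nth (fps_X * (fps_const (\<gamma> 1) + F_fps (shift \<gamma>))) n"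
  proof cases
    case 3
    let ?r = "\<Sum>k = 2..n - 1. F (n - k) (shift \<gamma>) * F k \<gamma>"
    \<comment> \<open>The recursion for \<open>F\<close> starts its sum at 2. The missing term
      \<open>k = 1\<close> of the convolution, multiplied by \<open>cnj (\<gamma> 1)\<close>, is
      what the factor \<open>1 - (cmod (\<gamma> 1))\<^sup>2\<close> subtracts.\<close>
    have "(\<Sum>k = 1..n - 1. F k \<gamma> * F (n - k) (shift \<gamma>)) =
        \<gamma> 1 * F (n - 1) (shift \<gamma>) + ?r"
      using 3 by (subst sum.atLeast_Suc_atMost) (auto simp: mult.commute numeral_2_eq_2)
    moreover have "F n \<gamma> = (1 - \<gamma> 1 * cnj (\<gamma> 1)) * F (n - 1) (shift \<gamma>) - cnj (\<gamma> 1) * ?r"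
      using 3 by (simp add: F.simps[of n] complex_norm_square flip: of_real_power)
    ultimately show ?thesis
      using 3 unfolding fps_add_nth fps_mult_left_const_nth conv by (simp add: algebra_simps)
  qed (simp_all add: conv)
qed

lemma T_fps_minus_1: "T_fps \<gamma> - 1 = T_fps \<gamma> * F_fps \<gamma>"
proof -
  \<comment> \<open>Since \<open>T 0\<close> is 1 but \<open>Q 0\<close> is 0, the series of the
    values of \<open>Q\<close> is \<open>T_fps \<gamma> - 1\<close>; the recursion for
    \<open>Q\<close> is this identity.\<close>
  have "T_fps \<gamma> - 1 = F_fps \<gamma> + (T_fps \<gamma> - 1) * F_fps \<gamma>"
  proof (rule fps_ext)
    fix n
    have conv: "fps_nth ((T_fps \<gamma> - 1) * F_fps \<gamma>) n =
        (\<Sum>k = 1..n - 1. F (n - k) \<gamma> * Q k (\<lambda>k. F k \<gamma>))"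
      by (subst fps_mult_nth_no_const) (auto intro!: sum.cong simp: T_def mult.commute)
    show "fps_nth (T_fps \<gamma> - 1) n = fps_nth (F_fps \<gamma> + (T_fps \<gamma> - 1) * F_fps \<gamma>) n"
      unfolding fps_add_nth conv
      by (auto simp: T_def Q.simps[of n "\<lambda>k. F k \<gamma>"])
  qed
  then show ?thesis
    by (simp add: algebra_simps)
qed

text \<open>This is the theorem as an identity of series. Each subtracted 1 removes a constant term,
  since the sum involves only \<open>T k\<close> and \<open>T (n - k)\<close> with positive
  indices.\<close>

lemma T_fps_recursion:
  "T_fps \<gamma> - 1 = fps_const (\<gamma> 1) * (fps_X * T_fps \<gamma>) +
     (T_fps (shift \<gamma>) - 1) * (fps_const (1 + \<gamma> 1) * (fps_X * T_fps \<gamma>)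
       - fps_const (1 + cnj (\<gamma> 1)) * (T_fps \<gamma> - 1))"
proof -
  define f g t s where "f = F_fps \<gamma>" and "g = F_fps (shift \<gamma>)"
    and "t = T_fps \<gamma>" and "s = T_fps (shift \<gamma>)"
  define a b where "a = fps_const (\<gamma> 1)" and "b = fps_const (cnj (\<gamma> 1))"
  have fg: "f + b * (f * g) = fps_X * (a + g)"
    using F_fps_functional_equation[of \<gamma>] by (simp add: f_def g_def a_def b_def)
  have t: "t - 1 = t * f" and s: "s - 1 = s * g"
    using T_fps_minus_1 by (simp_all add: f_def g_def t_def s_def)
  have unit: "s * (1 - g) = 1"
    using s by (simp add: algebra_simps)
  \<comment> \<open>Inserting \<open>s * (1 - g) = 1\<close> into the terms without \<open>s\<close>
    makes \<open>s * t\<close> a common factor; the terms \<open>f * g\<close> and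
    \<open>a * g * fps_X\<close> then cancel, and the cofactor is the difference of the two sides of
    \<open>fg\<close>.\<close>
  have "t * f - a * (fps_X * t) - s * g * ((1 + a) * (fps_X * t) - (1 + b) * (t * f)) =
      s * (1 - g) * (t * f - a * (fps_X * t))
        - s * g * ((1 + a) * (fps_X * t) - (1 + b) * (t * f))"
    by (simp add: unit)
  also have "\<dots> = s * t * (f + b * (f * g) - fps_X * (a + g))"
    by (simp add: algebra_simps)
  also have "\<dots> = 0"
    by (simp add: fg)
  finally have "t - 1 = a * (fps_X * t) + (s - 1) * ((1 + a) * (fps_X * t) - (1 + b) * (t - 1))"
    unfolding t s by (simp add: algebra_simps)
  moreover have "1 + a = fps_const (1 + \<gamma> 1)" "1 + b = fps_const (1 + cnj (\<gamma> 1))"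
    by (simp_all add: a_def b_def flip: fps_const_1_eq_1 fps_const_add)
  ultimately show ?thesis
    by (simp add: t_def s_def a_def)
qed

theorem theorem5p1:
  fixes n :: nat and \<gamma> :: "nat \<Rightarrow> complex"
  assumes "n \<ge> 1"
  shows "T n \<gamma> = \<gamma> 1 * T (n - 1) \<gamma>
    + (\<Sum>k = 1..n - 1. T k (shift \<gamma>) *
        ((1 + \<gamma> 1) * T (n - k - 1) \<gamma> - (1 + cnj (\<gamma> 1)) * T (n - k) \<gamma>))"
proof -
  let ?h = "fps_const (1 + \<gamma> 1) * (fps_X * T_fps \<gamma>) - fps_const (1 + cnj (\<gamma> 1)) * (T_fps \<gamma> - 1)"
  \<comment> \<open>At \<open>m = 0\<close> the coefficient is 0, as the convolution lemma requires,
    whereas truncated subtraction would make the right side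
    \<open>\<gamma> 1 - cnj (\<gamma> 1)\<close>.\<close>
  have h: "fps_nth ?h m = (1 + \<gamma> 1) * T (m - 1) \<gamma> - (1 + cnj (\<gamma> 1)) * T m \<gamma>" if "m \<ge> 1" for m
    unfolding fps_sub_nth fps_mult_left_const_nth using that by simp
  have "T n \<gamma> = fps_nth (T_fps \<gamma> - 1) n"
    using assms by simp
  also have "\<dots> = \<gamma> 1 * T (n - 1) \<gamma> + fps_nth ((T_fps (shift \<gamma>) - 1) * ?h) n"
    using assms by (subst T_fps_recursion) (simp only: fps_add_nth fps_mult_left_const_nth fps_X_mult_nth T_fps_nth, simp)
  also have "fps_nth ((T_fps (shift \<gamma>) - 1) * ?h) n =
      (\<Sum>k = 1..n - 1. fps_nth (T_fps (shift \<gamma>) - 1) k * fps_nth ?h (n - k))"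
    by (rule fps_mult_nth_no_const) simp_all
  also have "\<dots> = (\<Sum>k = 1..n - 1. T k (shift \<gamma>) *
        ((1 + \<gamma> 1) * T (n - k - 1) \<gamma> - (1 + cnj (\<gamma> 1)) * T (n - k) \<gamma>))"
  proof (rule sum.cong)
    fix k assume "k \<in> {1..n - 1}"
    then have "k \<noteq> 0" "n - k \<ge> 1" by auto
    then show "fps_nth (T_fps (shift \<gamma>) - 1) k * fps_nth ?h (n - k) = T k (shift \<gamma>) *
        ((1 + \<gamma> 1) * T (n - k - 1) \<gamma> - (1 + cnj (\<gamma> 1)) * T (n - k) \<gamma>)"
      unfolding h[OF \<open>n - k \<ge> 1\<close>] by simp
  qed simp
  finally show ?thesis .
qed

end
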